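(* Let $G$ be a finite simple graph on $n\geq 2$ vertices and $m$ edges, and let $\alpha$ be a real number. (1) If $\alpha>0$, then $$SO_\alpha(G)+SO_\alpha(\overline{G})\leq 2^{-1+\alpha/2}\,n(n-1)^{\alpha+1},$$ where equality holds if and only if $G=K_n$ or $G=\overline{K_n}$. Further, if $\alpha\geq 1$, then $$SO_\alpha(G)+SO_\alpha(\overline{G})\geq \frac{n(n-1)^{1+\alpha}}{2^{1+\alpha}},$$ and if $0<\alpha<1$, then $$SO_\alpha(G)+SO_\alpha(\overline{G})\geq \frac{n^{\alpha/2}(n-1)^{(3\alpha)/2}}{2^{(3\alpha)/2}}.$$ (2) If $\alpha<0$, then $$2^{-1+\alpha/2}\,n(n-1)^{\alpha+1}\leq SO_\alpha(G)+SO_\alpha(\overline{G})<2^{\alpha/2}\,n(n-1),$$ where equality on the left holds if and only if $G=K_n$ or $G=\overline{K_n}$.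
   Context: All graphs are finite and simple. $d_G(u)$ denotes the degree of the vertex $u$ in $G$. For real $\alpha$, the general Sombor index is $SO_\alpha(G)=\sum_{uv\in E(G)}[d_G(u)^2+d_G(v)^2]^{\alpha/2}$ (an empty sum is $0$). $\overline{G}$ is the complement of $G$: the simple graph on $V(G)$ in which two distinct vertices are adjacent if and only if they are not adjacent in $G$. $K_n$ is the complete graph on $n$ vertices. Equality of graphs means isomorphism. *)

theory Defs
  imports Complex_Main
begin

text \<open>A graph is a pair of a vertex set and a set of edges; the edge \<open>uv\<close> is the set \<open>{u, v}\<close>.\<close>

type_synonym 'a graph = "'a set \<times> 'a set set"

abbreviation verts :: "'a graph \<Rightarrow> 'a set" where
  "verts G \<equiv> fst G"

abbreviation edges :: "'a graph \<Rightarrow> 'a set set" where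
  "edges G \<equiv> snd G"

definition finite_simple_graph :: "'a graph \<Rightarrow> bool" where
  "finite_simple_graph G \<longleftrightarrow>
     finite (verts G) \<and>
     edges G \<subseteq> {{u, v} | u v. u \<in> verts G \<and> v \<in> verts G \<and> u \<noteq> v}"

definition degree :: "'a graph \<Rightarrow> 'a \<Rightarrow> nat" where
  "degree G u = card {e \<in> edges G. u \<in> e}"

text \<open>The inner sum ranges over the two endpoints of the edge \<open>e = {u, v}\<close>, so it is
  \<open>d(u)\<^sup>2 + d(v)\<^sup>2\<close>. It is positive, as endpoints of an edge have degree at least 1,
  so the convention for \<open>0 powr a\<close> is never used.\<close>

definition sombor :: "real \<Rightarrow> 'a graph \<Rightarrow> real" where
  "sombor \<alpha> G = (\<Sum>e\<in>edges G. (\<Sum>w\<in>e. (real (degree G w))\<^sup>2) powr (\<alpha> / 2))"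

definition complement :: "'a graph \<Rightarrow> 'a graph" where
  "complement G =
     (verts G, {{u, v} | u v. u \<in> verts G \<and> v \<in> verts G \<and> u \<noteq> v \<and> {u, v} \<notin> edges G})"

definition complete_graph :: "nat \<Rightarrow> nat graph" where
  "complete_graph n = ({..<n}, {{i, j} | i j. i < n \<and> j < n \<and> i \<noteq> j})"

definition graph_iso :: "'a graph \<Rightarrow> 'b graph \<Rightarrow> bool" where
  "graph_iso G H \<longleftrightarrow>
     (\<exists>f. bij_betw f (verts G) (verts H) \<and>
          (\<forall>u\<in>verts G. \<forall>v\<in>verts G. {u, v} \<in> edges G \<longleftrightarrow> {f u, f v} \<in> edges H))"

end

theory Submission
  imports Defs "HOL-Analysis.Convex"
begin

text \<open>The two indices together form one sum over all \<open>n (n - 1) / 2\<close> pairs \<open>e = uv\<close>, with terms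
  \<open>h(e) powr (\<alpha> / 2)\<close>, where \<open>h(e) = d(u)\<^sup>2 + d(v)\<^sup>2\<close> and degrees are taken in whichever of the
  two graphs contains \<open>e\<close>. Since \<open>2 \<le> h(e) \<le> 2 (n - 1)\<^sup>2\<close>, termwise comparison gives the bounds
  with \<open>n (n - 1)\<close> and \<open>n (n - 1) powr (\<alpha> + 1)\<close>.
  For the lower bounds with \<open>\<alpha> > 0\<close>, double counting turns the sum of \<open>d(u) + d(v)\<close> (resp. of
  \<open>h(e)\<close>) over all pairs into the sum of \<open>d\<^sup>j + (n - 1 - d)\<^sup>j\<close> over the vertices with \<open>j = 2\<close>
  (resp. \<open>j = 3\<close>), which is smallest at \<open>d = (n - 1) / 2\<close>; then convexity of \<open>x powr \<alpha>\<close> applies if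
  \<open>\<alpha> \<ge> 1\<close> and subadditivity of \<open>x powr (\<alpha> / 2)\<close> if \<open>\<alpha> < 1\<close>.\<close>

section \<open>Inequalities for sums of real powers\<close>

lemma powr_of_power:
  fixes x :: real
  assumes "x > 0"
  shows "(x ^ j) powr p = x powr (real j * p)"
  by (simp only: powr_realpow[OF assms, symmetric] powr_powr)

text \<open>With \<open>s\<close> the total of the \<open>x i\<close>, the exponent
  \<open>p - 1\<close> is at most 0, so \<open>x i \<le> s\<close> gives
  \<open>x i * s powr (p - 1) \<le> x i powr p\<close>. Summing over \<open>i\<close> turns the
  left-hand sides into \<open>s powr p\<close>.\<close>

lemma powr_sum_le_sum_powr:
  fixes x :: "'b \<Rightarrow> real"
  assumes "finite A" "\<And>i. i \<in> A \<Longrightarrow> x i > 0" "0 < p" "p \<le> 1"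
  shows "(\<Sum>i\<in>A. x i) powr p \<le> (\<Sum>i\<in>A. x i powr p)"
proof (cases "A = {}")
  case False
  define s where "s = (\<Sum>i\<in>A. x i)"
  have s: "s > 0"
    unfolding s_def using assms False by (intro sum_pos) auto
  have "x i * s powr (p - 1) \<le> x i powr p" if "i \<in> A" for i
  proof -
    have "x i \<le> s"
      unfolding s_def using assms(1,2) that by (intro member_le_sum) (auto intro: less_imp_le)
    then have "s powr (p - 1) \<le> x i powr (p - 1)"
      using assms that by (intro powr_mono2') auto
    then have "x i * s powr (p - 1) \<le> x i * x i powr (p - 1)"
      using assms(2)[OF that] by simp
    also have "\<dots> = x i powr p"
      using assms(2)[OF that] by (simp add: powr_diff)
    finally show ?thesis .
  qed
  then have "s * s powr (p - 1) \<le> (\<Sum>i\<in>A. x i powr p)"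
    unfolding s_def sum_distrib_right by (rule sum_mono)
  moreover have "s * s powr (p - 1) = s powr p"
    using s by (simp add: powr_diff)
  ultimately show ?thesis by (simp add: s_def)
qed simp

text \<open>Jensen's inequality for the convex function \<open>x powr p\<close> with equal weights
  \<open>1 / card A\<close>: the mean of the powers is at least the power of the mean, and the mean
  is at least \<open>c\<close>.\<close>

lemma card_mult_powr_le_sum_powr:
  fixes x :: "'b \<Rightarrow> real"
  assumes "finite A" "\<And>i. i \<in> A \<Longrightarrow> x i > 0" "1 \<le> p" "0 \<le> c"
    and "real (card A) * c \<le> (\<Sum>i\<in>A. x i)"
  shows "real (card A) * c powr p \<le> (\<Sum>i\<in>A. x i powr p)"
proof (cases "A = {}")
  case False
  then have N: "real (card A) > 0"
    using assms(1) by (simp add: card_gt_0_iff)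
  have "(\<Sum>i\<in>A. (1 / card A) *\<^sub>R x i) powr p \<le> (\<Sum>i\<in>A. (1 / card A) * x i powr p)"
    using assms N False by (intro convex_on_sum[OF _ _ powr_convex]) auto
  moreover have "c \<le> (\<Sum>i\<in>A. (1 / card A) *\<^sub>R x i)"
    using assms(5) N by (simp add: field_simps flip: sum_divide_distrib)
  then have "c powr p \<le> (\<Sum>i\<in>A. (1 / card A) *\<^sub>R x i) powr p"
    using assms by (intro powr_mono2) auto
  ultimately have "c powr p \<le> (\<Sum>i\<in>A. (1 / card A) * x i powr p)"
    by linarith
  then show ?thesis
    using N by (simp add: field_simps flip: sum_divide_distrib)
qed simp

text \<open>Equality case of a termwise estimate. Both directions of the estimate are allowed
  because the bound is an upper one for \<alpha> > 0 and a lower one for \<alpha> < 0.\<close>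

lemma sum_eq_card_mult_iff:
  fixes g :: "'b \<Rightarrow> real"
  assumes "finite A" "(\<forall>i\<in>A. g i \<le> c) \<or> (\<forall>i\<in>A. c \<le> g i)"
  shows "(\<Sum>i\<in>A. g i) = real (card A) * c \<longleftrightarrow> (\<forall>i\<in>A. g i = c)"
proof -
  have "(\<Sum>i\<in>A. g i) = real (card A) * c \<longleftrightarrow> (\<Sum>i\<in>A. g i) = (\<Sum>i\<in>A. c)"
    by simp
  also have "\<dots> \<longleftrightarrow> (\<forall>i\<in>A. g i = c)"
    using assms sum_mono_inv[of g A "\<lambda>_. c"] sum_mono_inv[of "\<lambda>_. c" A g]
    by (metis sum.cong)
  finally show ?thesis .
qed

section \<open>Edges and degrees of a graph and its complement\<close>

lemma finite_edges:
  assumes "finite_simple_graph G"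
  shows "finite (edges G)"
proof -
  have "edges G \<subseteq> Pow (verts G)"
    using assms by (auto simp: finite_simple_graph_def)
  then show ?thesis
    using assms finite_subset by (auto simp: finite_simple_graph_def)
qed

lemma edgeE:
  assumes "finite_simple_graph G" "e \<in> edges G"
  obtains u v where "e = {u, v}" "u \<in> verts G" "v \<in> verts G" "u \<noteq> v"
  using assms by (auto simp: finite_simple_graph_def)

lemma verts_complement [simp]: "verts (complement G) = verts G"
  by (simp add: complement_def)

lemma finite_simple_graph_complement:
  "finite_simple_graph G \<Longrightarrow> finite_simple_graph (complement G)"
  by (auto simp: finite_simple_graph_def complement_def)

lemma edges_Int_complement: "edges G \<inter> edges (complement G) = {}"
  by (auto simp: complement_def)

lemma edges_Un_complement:
  assumes "finite_simple_graph G"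
  shows "edges G \<union> edges (complement G) =
    {{u, v} | u v. u \<in> verts G \<and> v \<in> verts G \<and> u \<noteq> v}"
  using assms by (auto simp: finite_simple_graph_def complement_def)

lemma degree_pos:
  assumes "finite_simple_graph G" "e \<in> edges G" "w \<in> e"
  shows "1 \<le> degree G w"
proof -
  have "{e \<in> edges G. w \<in> e} \<noteq> {}" using assms by auto
  then show ?thesis
    using finite_edges[OF assms(1)] by (simp add: degree_def Suc_le_eq card_gt_0_iff)
qed

text \<open>The edges at \<open>u\<close> in the two graphs are disjoint families that together form
  all pairs \<open>{u, v}\<close> with \<open>v\<close> another vertex.\<close>

lemma degree_add_degree_complement:
  assumes "finite_simple_graph G" "u \<in> verts G"
  shows "degree G u + degree (complement G) u = card (verts G) - 1"
proof -
  let ?E = "{e \<in> edges G. u \<in> e}" and ?F = "{e \<in> edges (complement G). u \<in> e}"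
  have "card (?E \<union> ?F) = card ?E + card ?F"
    using finite_edges[OF assms(1)] finite_edges[OF finite_simple_graph_complement[OF assms(1)]]
      edges_Int_complement[of G]
    by (intro card_Un_disjoint) auto
  moreover have "?E \<union> ?F = {e \<in> edges G \<union> edges (complement G). u \<in> e}" by blast
  moreover have "\<dots> = (\<lambda>v. {u, v}) ` (verts G - {u})"
    using assms by (auto simp: edges_Un_complement)
  moreover have "card \<dots> = card (verts G) - 1"
    using assms by (subst card_image) (auto simp: inj_on_def doubleton_eq_iff)
  ultimately show ?thesis by (simp add: degree_def)
qed

text \<open>Double counting of incidences: after swapping the sums, \<open>f w\<close> occurs once
  for every edge containing \<open>w\<close>.\<close>

lemma sum_edges_sum_endpoints:
  fixes f :: "'a \<Rightarrow> real"
  assumes "finite_simple_graph G"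
  shows "(\<Sum>e\<in>edges G. \<Sum>w\<in>e. f w) = (\<Sum>w\<in>verts G. real (degree G w) * f w)"
proof -
  have "(\<Sum>e\<in>edges G. \<Sum>w\<in>e. f w) = (\<Sum>e\<in>edges G. \<Sum>w\<in>{w \<in> verts G. w \<in> e}. f w)"
    using assms by (intro sum.cong refl) (auto elim!: edgeE)
  also have "\<dots> = (\<Sum>w\<in>verts G. \<Sum>e\<in>{e \<in> edges G. w \<in> e}. f w)"
    using assms finite_edges[OF assms]
    by (intro sum.swap_restrict) (simp_all add: finite_simple_graph_def)
  finally show ?thesis by (simp add: degree_def)
qed

section \<open>The extremal graphs\<close>

lemma graph_iso_complete_iff:
  assumes G: "finite_simple_graph G" and n: "card (verts G) = n"
  shows "graph_iso G (complete_graph n) \<longleftrightarrow> edges (complement G) = {}"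
proof
  assume "graph_iso G (complete_graph n)"
  then obtain f where f: "bij_betw f (verts G) {..<n}"
    and e: "\<forall>u\<in>verts G. \<forall>v\<in>verts G. {u, v} \<in> edges G \<longleftrightarrow> {f u, f v} \<in> edges (complete_graph n)"
    by (auto simp: graph_iso_def complete_graph_def)
  have "{u, v} \<in> edges G" if "u \<in> verts G" "v \<in> verts G" "u \<noteq> v" for u v
  proof -
    have "f u < n" "f v < n" "f u \<noteq> f v"
      using f that by (auto simp: bij_betw_def inj_on_def)
    then show ?thesis using e that by (auto simp: complete_graph_def)
  qed
  then show "edges (complement G) = {}" by (auto simp: complement_def)
next
  assume "edges (complement G) = {}"
  then have e: "edges G = {{u, v} | u v. u \<in> verts G \<and> v \<in> verts G \<and> u \<noteq> v}"
    using edges_Un_complement[OF G] by simp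
  have "finite (verts G)" using G by (simp add: finite_simple_graph_def)
  then obtain f where f: "bij_betw f (verts G) {..<n}"
    using n ex_bij_betw_finite_nat[of "verts G"] by (auto simp: atLeast0LessThan)
  have "{u, v} \<in> edges G \<longleftrightarrow> {f u, f v} \<in> edges (complete_graph n)"
    if "u \<in> verts G" "v \<in> verts G" for u v
  proof -
    have "f u < n" "f v < n" "f u = f v \<longleftrightarrow> u = v"
      using f that by (auto simp: bij_betw_def inj_on_def)
    then show ?thesis
      using that unfolding e complete_graph_def by (auto simp: doubleton_eq_iff)
  qed
  then show "graph_iso G (complete_graph n)"
    using f unfolding graph_iso_def by (auto simp: complete_graph_def)
qed

text \<open>Between edgeless graphs every bijection of the vertex sets is an isomorphism, and one
  exists since both have \<open>n\<close> vertices. Conversely, an edge of \<open>G\<close> would be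
  mapped to an edge of an edgeless graph.\<close>

lemma graph_iso_complement_complete_iff:
  assumes G: "finite_simple_graph G" and n: "card (verts G) = n"
  shows "graph_iso G (complement (complete_graph n)) \<longleftrightarrow> edges G = {}"
proof -
  have K: "edges (complement (complete_graph n)) = {}"
    by (auto simp: complement_def complete_graph_def)
  have V: "verts (complement (complete_graph n)) = {..<n}"
    by (simp add: complete_graph_def)
  have "finite (verts G)" using G by (simp add: finite_simple_graph_def)
  then obtain f where "bij_betw f (verts G) {..<n}"
    using n ex_bij_betw_finite_nat[of "verts G"] by (auto simp: atLeast0LessThan)
  then show ?thesis
    using edgeE[OF G] unfolding graph_iso_def K V by blast
qed

text \<open>If both graphs have an edge, an endpoint \<open>u\<close> of an edge of \<open>G\<close> and an endpoint \<open>x\<close>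
  of an edge of the complement are isolated in the respective other graph, so \<open>ux\<close> can be an
  edge of neither.\<close>

lemma all_degrees_max_iff:
  assumes G: "finite_simple_graph G" and n: "card (verts G) = n"
  shows "(\<forall>e\<in>edges G. \<forall>w\<in>e. degree G w = n - 1) \<and>
         (\<forall>e\<in>edges (complement G). \<forall>w\<in>e. degree (complement G) w = n - 1) \<longleftrightarrow>
         edges (complement G) = {} \<or> edges G = {}"
    (is "?L \<longleftrightarrow> ?R")
proof
  assume L: ?L
  show ?R
  proof (rule ccontr)
    assume "\<not> ?R"
    then obtain e e' where e: "e \<in> edges G" and e': "e' \<in> edges (complement G)" by auto
    obtain u v where uv: "e = {u, v}" "u \<in> verts G" using edgeE[OF G e] by metis
    obtain x y where xy: "e' = {x, y}" "x \<in> verts G" "y \<in> verts G" "x \<noteq> y"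
      using edgeE[OF finite_simple_graph_complement[OF G] e'] by auto
    have no_G: "degree G w = 0" if "w \<in> e'" for w
      using L e' that degree_add_degree_complement[OF G, of w] n xy by auto
    have "degree (complement G) u = 0"
      using L e uv degree_add_degree_complement[OF G, of u] n by auto
    then have "u \<notin> e''" if "e'' \<in> edges (complement G)" for e''
      using degree_pos[OF finite_simple_graph_complement[OF G] that, of u] by auto
    then have "x \<noteq> u" "{u, x} \<notin> edges (complement G)" using e' xy by auto
    then have "{u, x} \<in> edges G"
      using uv xy by (auto simp: complement_def)
    then show False
      using degree_pos[OF G, of "{u, x}" x] no_G[of x] xy by simp
  qed
next
  assume ?R
  then show ?L
  proof
    assume *: "edges (complement G) = {}"
    have "degree (complement G) w = 0" for w by (simp add: degree_def *)
    then show ?L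
      using degree_add_degree_complement[OF G] n * by (auto elim!: edgeE[OF G])
  next
    assume *: "edges G = {}"
    have "degree G w = 0" for w by (simp add: degree_def *)
    then show ?L
      using degree_add_degree_complement[OF G] n *
      by (auto elim!: edgeE[OF finite_simple_graph_complement[OF G]])
  qed
qed

section \<open>Splitting \<open>k\<close> into two summands\<close>

lemma sum_squares_split: "k^2 / 2 \<le> (d::real)^2 + (k - d)^2"
proof -
  have "d^2 + (k - d)^2 - k^2 / 2 = 2 * (d - k / 2)^2" by algebra
  then show ?thesis by (smt (verit) zero_le_power2)
qed

text \<open>The cubic terms in \<open>d\<close> cancel, so the difference of the two sides is a
  square around \<open>d = k / 2\<close> with the nonnegative factor \<open>3 * k\<close>.\<close>

lemma sum_cubes_split:
  assumes "0 \<le> (k::real)"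
  shows "k^3 / 4 \<le> d^3 + (k - d)^3"
proof -
  have "d^3 + (k - d)^3 - k^3 / 4 = 3 * k * (d - k / 2)^2" by algebra
  moreover have "0 \<le> 3 * k * (d - k / 2)^2" using assms by simp
  ultimately show ?thesis by linarith
qed

section \<open>Bounds of Nordhaus-Gaddum type for the Sombor index\<close>

theorem theorem3p4:
  fixes G :: "'a graph" and n m :: nat and \<alpha> :: real
  assumes "finite_simple_graph G"
    and "card (verts G) = n" and "n \<ge> 2"
    and "card (edges G) = m"
  shows
    "(\<alpha> > 0 \<longrightarrow>
        sombor \<alpha> G + sombor \<alpha> (complement G)
          \<le> 2 powr (-1 + \<alpha> / 2) * real n * (real n - 1) powr (\<alpha> + 1)
        \<and> (sombor \<alpha> G + sombor \<alpha> (complement G)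
              = 2 powr (-1 + \<alpha> / 2) * real n * (real n - 1) powr (\<alpha> + 1)
            \<longleftrightarrow> graph_iso G (complete_graph n) \<or> graph_iso G (complement (complete_graph n)))
        \<and> (\<alpha> \<ge> 1 \<longrightarrow>
              sombor \<alpha> G + sombor \<alpha> (complement G)
                \<ge> real n * (real n - 1) powr (1 + \<alpha>) / 2 powr (1 + \<alpha>))
        \<and> (\<alpha> < 1 \<longrightarrow>
              sombor \<alpha> G + sombor \<alpha> (complement G)
                \<ge> real n powr (\<alpha> / 2) * (real n - 1) powr (3 * \<alpha> / 2) / 2 powr (3 * \<alpha> / 2)))
     \<and> (\<alpha> < 0 \<longrightarrow>
        2 powr (-1 + \<alpha> / 2) * real n * (real n - 1) powr (\<alpha> + 1)
          \<le> sombor \<alpha> G + sombor \<alpha> (complement G)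
        \<and> sombor \<alpha> G + sombor \<alpha> (complement G)
          < 2 powr (\<alpha> / 2) * real n * (real n - 1)
        \<and> (2 powr (-1 + \<alpha> / 2) * real n * (real n - 1) powr (\<alpha> + 1)
              = sombor \<alpha> G + sombor \<alpha> (complement G)
            \<longleftrightarrow> graph_iso G (complete_graph n) \<or> graph_iso G (complement (complete_graph n))))"
proof -
  note G = assms(1)
  note cG = finite_simple_graph_complement[OF G]
  let ?E = "edges G" and ?F = "edges (complement G)"
  define A where "A = ?E \<union> ?F"
  define k where "k = real n - 1"
  define S where "S = sombor \<alpha> G + sombor \<alpha> (complement G)"
  define d where "d e w = real (if e \<in> ?E then degree G w else degree (complement G) w)" for e w
  \<comment> \<open>The linear counterpart of \<open>h\<close>: for \<alpha> \<ge> 1 the convexity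
    bound is obtained for \<open>s e / 2\<close> and then carried over to
    \<open>h e\<close>.\<close>
  define s where "s e = (\<Sum>w\<in>e. d e w)" for e
  define h where "h e = (\<Sum>w\<in>e. (d e w)\<^sup>2)" for e
  have k: "1 \<le> k" using assms(3) by (simp add: k_def)
  have finA: "finite A" by (simp add: A_def finite_edges G cG)
  have notE: "e \<notin> ?E" if "e \<in> ?F" for e using that edges_Int_complement[of G] by blast
  have sumA: "(\<Sum>e\<in>A. g e) = (\<Sum>e\<in>?E. g e) + (\<Sum>e\<in>?F. g e)" for g :: "'a set \<Rightarrow> real"
    unfolding A_def by (intro sum.union_disjoint) (simp_all add: finite_edges G cG edges_Int_complement)
  have S: "S = (\<Sum>e\<in>A. h e powr (\<alpha> / 2))"
    unfolding sumA S_def sombor_def h_def d_def by (simp add: notE)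
  have co: "real (degree (complement G) w) = k - real (degree G w)" if "w \<in> verts G" for w
    using degree_add_degree_complement[OF G that] assms(2,3) unfolding k_def by linarith

  \<comment> \<open>Used with \<open>j = 0\<close> to count the pairs, \<open>j = 1\<close> to sum
    \<open>s\<close> and \<open>j = 2\<close> to sum \<open>h\<close>.\<close>
  have sum_deg: "(\<Sum>e\<in>A. \<Sum>w\<in>e. d e w ^ j) =
      (\<Sum>w\<in>verts G. real (degree G w) ^ Suc j + (k - real (degree G w)) ^ Suc j)" for j
  proof -
    have "(\<Sum>e\<in>A. \<Sum>w\<in>e. d e w ^ j) =
        (\<Sum>e\<in>?E. \<Sum>w\<in>e. real (degree G w) ^ j) +
        (\<Sum>e\<in>?F. \<Sum>w\<in>e. real (degree (complement G) w) ^ j)"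
      unfolding sumA d_def by (simp add: notE)
    also have "\<dots> = (\<Sum>w\<in>verts G. real (degree G w) ^ Suc j) +
        (\<Sum>w\<in>verts G. real (degree (complement G) w) ^ Suc j)"
      by (simp add: sum_edges_sum_endpoints G cG)
    also have "\<dots> = (\<Sum>w\<in>verts G. real (degree G w) ^ Suc j + (k - real (degree G w)) ^ Suc j)"
      by (simp add: sum.distrib co)
    finally show ?thesis .
  qed
  have edge: "\<exists>u v. e = {u, v} \<and> u \<noteq> v \<and> u \<in> verts G \<and> v \<in> verts G" if "e \<in> A" for e
    using that edgeE[OF G] edgeE[OF cG] unfolding A_def by (metis Un_iff verts_complement)
  have d_bounds: "1 \<le> d e w" "d e w \<le> k" if "e \<in> A" "w \<in> e" for e w
  proof -
    show "1 \<le> d e w"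
      using that degree_pos[OF G] degree_pos[OF cG] unfolding A_def d_def by fastforce
    have "w \<in> verts G" using edge[OF that(1)] that(2) by auto
    \<comment> \<open>The degrees of \<open>w\<close> in the two graphs are nonnegative and add up
      to \<open>k\<close>.\<close>
    from co[OF this] show "d e w \<le> k" by (simp add: d_def)
  qed
  have N: "real (card A) = real n * k / 2"
  proof -
    have "(\<Sum>e\<in>A. \<Sum>w\<in>e. d e w ^ 0) = (\<Sum>e\<in>A. 2)"
    proof (rule sum.cong[OF refl])
      fix e assume "e \<in> A"
      from edge[OF this] show "(\<Sum>w\<in>e. d e w ^ 0) = 2" by (auto simp: card_2_iff)
    qed
    then show ?thesis unfolding sum_deg using assms(2) by simp
  qed
  have h_ge: "2 \<le> h e" and h_le: "h e \<le> 2 * k\<^sup>2"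
    and h_max: "h e = 2 * k\<^sup>2 \<longleftrightarrow> (\<forall>w\<in>e. d e w = k)"
    and s_pos: "0 < s e" and s_h: "(s e / 2)\<^sup>2 \<le> h e" if "e \<in> A" for e
  proof -
    obtain u v where e: "e = {u, v}" "u \<noteq> v" using edge[OF \<open>e \<in> A\<close>] by auto
    have h: "h e = (d e u)\<^sup>2 + (d e v)\<^sup>2" and s: "s e = d e u + d e v"
      by (simp_all add: h_def s_def e)
    have b: "1 \<le> d e u" "1 \<le> d e v" "d e u \<le> k" "d e v \<le> k"
      using d_bounds[OF \<open>e \<in> A\<close>] e by auto
    have sq: "1 \<le> (d e u)\<^sup>2" "1 \<le> (d e v)\<^sup>2" "(d e u)\<^sup>2 \<le> k\<^sup>2" "(d e v)\<^sup>2 \<le> k\<^sup>2"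
      using b by (auto intro: power_mono)
    show "2 \<le> h e" "h e \<le> 2 * k\<^sup>2" "0 < s e" using sq b unfolding h s by linarith+
    have "h e = 2 * k\<^sup>2 \<longleftrightarrow> (d e u)\<^sup>2 = k\<^sup>2 \<and> (d e v)\<^sup>2 = k\<^sup>2"
      using sq unfolding h by linarith
    also have "\<dots> \<longleftrightarrow> d e u = k \<and> d e v = k"
      using b k by (simp add: power2_eq_iff_nonneg)
    finally show "h e = 2 * k\<^sup>2 \<longleftrightarrow> (\<forall>w\<in>e. d e w = k)" by (auto simp: e)
    \<comment> \<open>The divisor 4 in place of 2 is weaker, but it is what the constant stated for
      \<alpha> \<ge> 1 calls for.\<close>
    have "(s e / 2)\<^sup>2 \<le> (s e)\<^sup>2 / 2" by (simp add: power_divide)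
    also have "\<dots> \<le> h e"
      using sum_squares_split[of "s e" "d e u"] unfolding h s by simp
    finally show "(s e / 2)\<^sup>2 \<le> h e" .
  qed

  \<comment> \<open>Termwise comparison with the maximal value of \<open>h\<close>\<close>
  define c where "c = (2 * k\<^sup>2) powr (\<alpha> / 2)"
  have bound: "2 powr (-1 + \<alpha> / 2) * real n * (real n - 1) powr (\<alpha> + 1) = real (card A) * c"
  proof -
    have "c = 2 powr (\<alpha> / 2) * k powr \<alpha>"
      unfolding c_def using k by (simp add: powr_mult powr_of_power)
    moreover have "2 powr (-1 + \<alpha> / 2) = 2 powr (\<alpha> / 2) / 2"
      using powr_add[of 2 "-1" "\<alpha> / 2"] by (simp add: powr_minus_divide)
    ultimately show ?thesis
      unfolding N k_def[symmetric] using k by (simp add: powr_add)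
  qed
  have extremal: "(\<forall>e\<in>A. h e powr (\<alpha> / 2) = c) \<longleftrightarrow>
      graph_iso G (complete_graph n) \<or> graph_iso G (complement (complete_graph n))"
    if "\<alpha> \<noteq> 0"
  proof -
    have "h e powr (\<alpha> / 2) = c \<longleftrightarrow> h e = 2 * k\<^sup>2" if "e \<in> A" for e
    proof
      assume "h e powr (\<alpha> / 2) = c"
      \<comment> \<open>The exponent \<open>2 / \<alpha>\<close> undoes \<open>\<alpha> / 2\<close>,
        which is where \<alpha> \<noteq> 0 enters.\<close>
      then have "(h e powr (\<alpha> / 2)) powr (2 / \<alpha>) = c powr (2 / \<alpha>)" by simp
      then show "h e = 2 * k\<^sup>2"
        using h_ge[OF that] \<open>\<alpha> \<noteq> 0\<close> unfolding c_def by (simp add: powr_powr)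
    qed (simp add: c_def)
    then have "(\<forall>e\<in>A. h e powr (\<alpha> / 2) = c) \<longleftrightarrow> (\<forall>e\<in>A. \<forall>w\<in>e. d e w = k)"
      using h_max by blast
    also have "\<dots> \<longleftrightarrow> (\<forall>e\<in>?E. \<forall>w\<in>e. real (degree G w) = k) \<and>
        (\<forall>e\<in>?F. \<forall>w\<in>e. real (degree (complement G) w) = k)"
      unfolding A_def d_def using notE by auto
    also have "\<dots> \<longleftrightarrow> (\<forall>e\<in>?E. \<forall>w\<in>e. degree G w = n - 1) \<and>
        (\<forall>e\<in>?F. \<forall>w\<in>e. degree (complement G) w = n - 1)"
    proof -
      have "k = real (n - 1)" using assms(3) by (simp add: k_def)
      then show ?thesis by simp
    qed
    also have "\<dots> \<longleftrightarrow> graph_iso G (complete_graph n) \<or>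
        graph_iso G (complement (complete_graph n))"
      unfolding graph_iso_complete_iff[OF G assms(2)]
        graph_iso_complement_complete_iff[OF G assms(2)]
      by (rule all_degrees_max_iff[OF G assms(2)])
    finally show ?thesis .
  qed

  have pos_le: "\<forall>e\<in>A. h e powr (\<alpha> / 2) \<le> c" if "\<alpha> > 0"
  proof
    fix e assume "e \<in> A"
    then show "h e powr (\<alpha> / 2) \<le> c"
      unfolding c_def using h_ge[of e] h_le[of e] that by (intro powr_mono2) auto
  qed
  have neg_ge: "\<forall>e\<in>A. c \<le> h e powr (\<alpha> / 2)" if "\<alpha> < 0"
  proof
    fix e assume "e \<in> A"
    then show "c \<le> h e powr (\<alpha> / 2)"
      unfolding c_def using h_ge[of e] h_le[of e] that by (intro powr_mono2') auto
  qed
  have eq_iff: "S = real (card A) * c \<longleftrightarrow>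
      graph_iso G (complete_graph n) \<or> graph_iso G (complement (complete_graph n))"
    if "\<alpha> \<noteq> 0"
    unfolding S extremal[OF that, symmetric]
    using pos_le neg_ge that by (intro sum_eq_card_mult_iff finA) linarith
  have upper: "S \<le> real (card A) * c" if "\<alpha> > 0"
    unfolding S using pos_le[OF that] by (intro sum_bounded_above) auto
  have lower: "real (card A) * c \<le> S" if "\<alpha> < 0"
    unfolding S using neg_ge[OF that] by (intro sum_bounded_below) auto

  \<comment> \<open>Lower bounds for positive \<alpha>\<close>
  have ge1: "real n * (real n - 1) powr (1 + \<alpha>) / 2 powr (1 + \<alpha>) \<le> S" if "\<alpha> \<ge> 1"
  proof -
    have "real n * (k\<^sup>2 / 2) \<le> (\<Sum>e\<in>A. s e)"
    proof -
      have "real n * (k\<^sup>2 / 2) = (\<Sum>w\<in>verts G. k\<^sup>2 / 2)" using assms(2) by simp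
      also have "\<dots> \<le> (\<Sum>w\<in>verts G. (real (degree G w))\<^sup>2 + (k - real (degree G w))\<^sup>2)"
        by (intro sum_mono sum_squares_split)
      also have "\<dots> = (\<Sum>e\<in>A. s e)"
        using sum_deg[of 1] by (simp add: s_def numeral_2_eq_2)
      finally show ?thesis .
    qed
    \<comment> \<open>Both sides are halved; by \<open>N\<close>, half of \<open>n * k^2 / 2\<close>
      is \<open>card A * (k / 2)\<close>, so the mean of \<open>s e / 2\<close> is at least
      \<open>k / 2\<close>.\<close>
    then have "real (card A) * (k / 2) \<le> (\<Sum>e\<in>A. s e / 2)"
      unfolding N by (simp add: power2_eq_square mult_ac flip: sum_divide_distrib)
    then have "real (card A) * (k / 2) powr \<alpha> \<le> (\<Sum>e\<in>A. (s e / 2) powr \<alpha>)"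
      using s_pos k that by (intro card_mult_powr_le_sum_powr finA) auto
    also have "\<dots> \<le> S"
      unfolding S
    proof (rule sum_mono)
      fix e assume e: "e \<in> A"
      have "(s e / 2) powr \<alpha> = ((s e / 2)\<^sup>2) powr (\<alpha> / 2)"
        using s_pos[OF e] powr_of_power[of "s e / 2" 2 "\<alpha> / 2"] by simp
      also have "\<dots> \<le> h e powr (\<alpha> / 2)"
        using s_h[OF e] that by (intro powr_mono2) auto
      finally show "(s e / 2) powr \<alpha> \<le> h e powr (\<alpha> / 2)" .
    qed
    finally show ?thesis
      unfolding N k_def[symmetric] using k by (simp add: powr_add powr_divide mult_ac)
  qed

  have lt1: "real n powr (\<alpha> / 2) * (real n - 1) powr (3 * \<alpha> / 2) / 2 powr (3 * \<alpha> / 2) \<le> S"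
    if "0 < \<alpha>" "\<alpha> < 1"
  proof -
    \<comment> \<open>The denominator 8 is chosen because \<open>8 powr (\<alpha> / 2)\<close>
      equals \<open>2 powr (3 * \<alpha> / 2)\<close>, the denominator of the claim.\<close>
    have "real n * k ^ 3 / 8 \<le> real n * (k ^ 3 / 4)" using k by simp
    also have "\<dots> = (\<Sum>w\<in>verts G. k ^ 3 / 4)" using assms(2) by simp
    also have "\<dots> \<le> (\<Sum>w\<in>verts G. real (degree G w) ^ 3 + (k - real (degree G w)) ^ 3)"
      using k by (intro sum_mono sum_cubes_split) simp
    also have "\<dots> = (\<Sum>e\<in>A. h e)"
      using sum_deg[of 2] by (simp add: h_def eval_nat_numeral)
    finally have "(real n * k ^ 3 / 8) powr (\<alpha> / 2) \<le> (\<Sum>e\<in>A. h e) powr (\<alpha> / 2)"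
      using k that by (intro powr_mono2) auto
    also have "\<dots> \<le> S"
      unfolding S using h_ge that by (intro powr_sum_le_sum_powr finA) force+
    finally have "(real n * k ^ 3 / 8) powr (\<alpha> / 2) \<le> S" .
    moreover have "(real n * k ^ 3 / 8) powr (\<alpha> / 2) =
        real n powr (\<alpha> / 2) * k powr (3 * \<alpha> / 2) / 2 powr (3 * \<alpha> / 2)"
      using k powr_of_power[of 2 3 "\<alpha> / 2"] by (simp add: powr_mult powr_divide powr_of_power)
    ultimately show ?thesis by (simp add: k_def)
  qed

  \<comment> \<open>Strict upper bound for negative \<alpha>\<close>
  have lt: "S < 2 powr (\<alpha> / 2) * real n * (real n - 1)" if "\<alpha> < 0"
  proof -
    have "S \<le> real (card A) * 2 powr (\<alpha> / 2)"
      unfolding S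
    proof (rule sum_bounded_above)
      fix e assume "e \<in> A"
      then show "h e powr (\<alpha> / 2) \<le> 2 powr (\<alpha> / 2)"
        using h_ge[of e] that by (intro powr_mono2') auto
    qed
    \<comment> \<open>The termwise bound already yields half of the claimed value; strictness comes
      from this factor, as the value is positive.\<close>
    also have "\<dots> = (2 powr (\<alpha> / 2) * real n * k) / 2" by (simp add: N)
    also have "\<dots> < 2 powr (\<alpha> / 2) * real n * k" using k assms(3) by simp
    finally show ?thesis by (simp add: k_def)
  qed

  show ?thesis
    unfolding bound S_def[symmetric] using upper lower eq_iff ge1 lt1 lt by (smt (verit))
qed

end
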